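(* Let $n\ge3$. The map $g$ defined below is a bijection of $\mathrm{And}_n^{I}$ onto itself. Furthermore, if $((p_1,q_1),\dots,(p_r,q_r))$ is the canonical factorization type of $w\in\mathrm{And}_n^{I}$, then $((n+1-q_1,n+1-p_1),\dots,(n+1-q_r,n+1-p_r))$ is the canonical factorization type of $g(w)$. In particular $(\mathbf{F}\,g(w),\mathbf{spi}\,g(w))=(n+1-\mathbf{spi}\,w,\ n+1-\mathbf{F}\,w)$.
   Context: Andr\'e I permutations: words are permutations of finite sets $Y$ of positive integers; the empty word and one-letter words are Andr\'e I; for $|Y|\ge2$ write $w=v\,\min(w)\,v'$; $w$ is Andr\'e I if $v,v'$ are Andr\'e I and $\max(vv')$ is a letter of $v'$. $\mathrm{And}_n^{I}$: Andr\'e I permutations of $\{1,\dots,n\}$. For $w=x_1\cdots x_n$: $\mathbf{F}\,w=x_1$, $\mathbf{L}\,w=x_n$; $\mathbf{spi}\,w$ is the letter $x_i$ such that $x_1\le x_j$ for all $j\le i$ and $x_1>x_{i+1}$ (convention $x_{n+1}=0$). A left minimum record of $w$ is a letter smaller than all letters to its left (the first letter is one). Canonical factorization: if $1=a_1<a_2<\cdots<a_r$ are the positions of the left minimum records of $w$, put $v_j=x_{a_j}\cdots x_{a_{j+1}-1}$ ($a_{r+1}:=n+1$), so $w=v_1v_2\cdots v_r$; its type is $((\mathbf{F}\,v_1,\mathbf{L}\,v_1),\dots,(\mathbf{F}\,v_r,\mathbf{L}\,v_r))$. For a word $v=y_1\cdots y_l$ and $N=n+1$, let $\overline v=(N-y_l)(N-y_{l-1})\cdots(N-y_1)$.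 Define $g(w)=\overline{v_1}\,\overline{v_2}\cdots\overline{v_r}$. *)

theory Defs
  imports Main "HOL-Combinatorics.Multiset_Permutations"
begin

inductive andre_I :: "nat list \<Rightarrow> bool" where
  empty: "andre_I []"
| single: "0 < x \<Longrightarrow> andre_I [x]"
| split: "\<lbrakk>distinct (v @ m # v'); \<forall>y \<in> set (v @ m # v'). 0 < y;
      v @ v' \<noteq> []; m = Min (set (v @ m # v'));
      andre_I v; andre_I v'; Max (set (v @ v')) \<in> set v'\<rbrakk>
    \<Longrightarrow> andre_I (v @ m # v')"

definition And_I :: "nat \<Rightarrow> nat list set" where
  "And_I n = {w \<in> permutations_of_set {1..n}. andre_I w}"

abbreviation F_letter :: "nat list \<Rightarrow> nat" where
  "F_letter w \<equiv> hd w"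

abbreviation L_letter :: "nat list \<Rightarrow> nat" where
  "L_letter w \<equiv> last w"

(* Positions are counted from 0 here and below; appending 0 to w encodes the
   convention that the letter after the last one is 0. *)
definition spi :: "nat list \<Rightarrow> nat" where
  "spi w = w ! (THE i. i < length w \<and> (\<forall>j\<le>i. w ! 0 \<le> w ! j) \<and> w ! 0 > (w @ [0]) ! Suc i)"

definition left_min_positions :: "nat list \<Rightarrow> nat list" where
  "left_min_positions w = filter (\<lambda>i. \<forall>j<i. w ! i < w ! j) [0..<length w]"

definition canonical_factorization :: "nat list \<Rightarrow> nat list list" where
  "canonical_factorization w =
     (let a = left_min_positions w @ [length w]
      in map (\<lambda>j. map ((!) w) [a ! j..<a ! Suc j]) [0..<length (left_min_positions w)])"

definition factorization_type :: "nat list \<Rightarrow> (nat \<times> nat) list" where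
  "factorization_type w = map (\<lambda>v. (F_letter v, L_letter v)) (canonical_factorization w)"

(* The subtraction does not truncate on words with letters in {1..N - 1}. *)
definition overline :: "nat \<Rightarrow> nat list \<Rightarrow> nat list" where
  "overline N v = rev (map (\<lambda>y. N - y) v)"

definition g :: "nat \<Rightarrow> nat list \<Rightarrow> nat list" where
  "g n w = concat (map (overline (n + 1)) (canonical_factorization w))"

end

theory Submission
  imports Defs
begin

text \<open>
  If \<open>w = v\<^sub>1 \<cdots> v\<^sub>r\<close> is the canonical factorization, then \<open>w\<close> is Andr\'e I iff every \<open>v\<^sub>j\<close> is and
  the last letters of the factors increase; moreover the last letter of an Andr\'e I word is its
  maximum. Reversing and complementing each factor exchanges the decrease of the first letters
  with the increase of the last ones, so everything reduces to one factor, i.e. to an Andr\'e I word that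
  begins with its minimum. For such words the Andr\'e I property is invariant under reverse-complement;
  this is seen from its non-recursive description: whenever \<open>x\<close> is smaller than all letters of a
  segment \<open>y \<cdots>\<close> immediately to its left, there is a letter \<open>z > y\<close> to the right of \<open>x\<close> such that
  all letters from \<open>x\<close> (exclusive) to \<open>z\<close> are larger than \<open>x\<close>.
\<close>

section \<open>Andr\'e I words\<close>

lemma andre_I_distinct_pos: "andre_I w \<Longrightarrow> distinct w \<and> (\<forall>y\<in>set w. 0 < y)"
  by (induction rule: andre_I.induct) auto

text \<open>At every split the largest letter of \<open>v @ v'\<close> lies in \<open>v'\<close>, so
  descending through the right-hand parts drives it to the final position.\<close>

lemma le_last_if_andre_I: "andre_I w \<Longrightarrow> x \<in> set w \<Longrightarrow> x \<le> last w"
proof (induction arbitrary: x rule: andre_I.induct)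
  case (split v m v')
  let ?M = "Max (set (v @ v'))"
  have "v' \<noteq> []" "?M \<le> last v'" using split by auto
  moreover have "m \<le> y" if "y \<in> set v'" for y
    using that split(4) by (metis Min_le UnCI finite_set in_set_conv_decomp list.set_intros(2) set_append)
  moreover have "y \<le> ?M" if "y \<in> set (v @ v')" for y using that by simp
  ultimately show ?case using split.prems by (fastforce intro: order_trans)
qed auto

text \<open>Inversion of the recursion at the minimum. The maximum condition is recast as domination
  of \<open>v\<close> by \<open>v'\<close>, which avoids \<open>Max\<close> and so also covers the
  case where both parts are empty.\<close>

lemma andre_I_split_iff:
  assumes "distinct (v @ m # v')" and "\<forall>y \<in> set (v @ m # v'). 0 < y"
    and m: "\<forall>y \<in> set v \<union> set v'. m < y"
  shows "andre_I (v @ m # v') \<longleftrightarrow>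
    andre_I v \<and> andre_I v' \<and> (\<forall>a\<in>set v. \<exists>b\<in>set v'. a < b)"
proof
  assume "andre_I (v @ m # v')"
  then show "andre_I v \<and> andre_I v' \<and> (\<forall>a\<in>set v. \<exists>b\<in>set v'. a < b)"
  proof cases
    case empty
    then show ?thesis by simp
  next
    case (single x)
    then show ?thesis by (simp add: append_eq_Cons_conv andre_I.empty)
  next
    case (split u k u')
    have eq: "v @ m # v' = u @ k # u'" by fact
    have "m = Min (set (v @ m # v'))"
      by (rule Min_eqI[symmetric]) (use m in \<open>auto intro: less_imp_le\<close>)
    \<comment> \<open>Both letters are the minimum of one word, and it occurs there only once; hence
      the two decompositions coincide.\<close>
    with split have "k = m" by simp
    moreover have "m \<notin> set v" "m \<notin> set v'" using assms(1) by auto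
    ultimately have u: "u = v" "u' = v'"
      using eq append_Cons_eq_iff[of m v v' u u'] by auto
    let ?M = "Max (set (v @ v'))"
    have M: "?M \<in> set v'" using split(8) unfolding u .
    have "a < ?M" if "a \<in> set v" for a
    proof -
      have "a \<le> ?M" using that by (intro Max_ge) auto
      moreover have "a \<noteq> ?M" using M that assms(1) by auto
      ultimately show ?thesis by simp
    qed
    then show ?thesis using split(6,7) M unfolding u by blast
  qed
next
  assume *: "andre_I v \<and> andre_I v' \<and> (\<forall>a\<in>set v. \<exists>b\<in>set v'. a < b)"
  show "andre_I (v @ m # v')"
  proof (cases "v @ v' = []")
    case True
    then show ?thesis using assms by (simp add: andre_I.single)
  next
    case False
    have "Max (set (v @ v')) \<in> set (v @ v')" using False by (intro Max_in) auto
    moreover have "Max (set (v @ v')) \<notin> set v"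
      using * by (metis List.finite_set Max_ge UnI2 leD set_append)
    ultimately have "Max (set (v @ v')) \<in> set v'" by auto
    moreover have "m = Min (set (v @ m # v'))"
      by (rule Min_eqI[symmetric]) (use m in \<open>auto intro: less_imp_le\<close>)
    ultimately show ?thesis using * assms False by (intro andre_I.split) auto
  qed
qed

text \<open>The non-recursive description, with \<open>y = f a\<close>, \<open>x = f i\<close> and
  \<open>z = f k\<close>. It is stated for a function on the interval from \<open>l\<close> to
  \<open>r\<close> (exclusive), so that factors of a word become subintervals without any shift of
  indices.\<close>

definition andre_seq :: "(nat \<Rightarrow> nat) \<Rightarrow> nat \<Rightarrow> nat \<Rightarrow> bool" where
  "andre_seq f l r \<longleftrightarrow> (\<forall>a i. l \<le> a \<and> a < i \<and> i < r \<and> (\<forall>j\<in>{a..<i}. f i < f j) \<longrightarrow>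
     (\<exists>k. i < k \<and> k < r \<and> (\<forall>j\<in>{i<..k}. f i < f j) \<and> f a < f k))"

lemma andre_seqD:
  assumes "andre_seq f l r" "l \<le> a" "a < i" "i < r" "\<And>j. a \<le> j \<Longrightarrow> j < i \<Longrightarrow> f i < f j"
  obtains k where "i < k" "k < r" "\<And>j. i < j \<Longrightarrow> j \<le> k \<Longrightarrow> f i < f j" "f a < f k"
  using assms unfolding andre_seq_def by (metis atLeastLessThan_iff greaterThanAtMost_iff)

lemma andre_seqI:
  assumes "\<And>a i. \<lbrakk>l \<le> a; a < i; i < r; \<And>j. a \<le> j \<Longrightarrow> j < i \<Longrightarrow> f i < f j\<rbrakk> \<Longrightarrow>
     \<exists>k. i < k \<and> k < r \<and> (\<forall>j. i < j \<and> j \<le> k \<longrightarrow> f i < f j) \<and> f a < f k"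
  shows "andre_seq f l r"
  unfolding andre_seq_def
proof (intro allI impI, elim conjE)
  fix a i assume "l \<le> a" "a < i" "i < r" "\<forall>j\<in>{a..<i}. f i < f j"
  then show "\<exists>k>i. k < r \<and> (\<forall>j\<in>{i<..k}. f i < f j) \<and> f a < f k"
    using assms[of a i] by auto
qed

text \<open>A witness \<open>k\<close> for a position \<open>i\<close> left of the minimum cannot
  lie at or beyond \<open>m\<close>, since all values up to \<open>k\<close> exceed
  \<open>f i\<close>. The instances with \<open>i = m\<close> are the domination condition, and none
  has \<open>a\<close> at or before \<open>m\<close> and \<open>i\<close> after it. Thus
  \<open>andre_seq\<close> obeys the recursion of \<open>andre_I_split_iff\<close>.\<close>

lemma andre_seq_split_iff:
  assumes "l \<le> m" "m < r" and m: "\<And>j. l \<le> j \<Longrightarrow> j < r \<Longrightarrow> j \<noteq> m \<Longrightarrow> f m < f j"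
  shows "andre_seq f l r \<longleftrightarrow>
    andre_seq f l m \<and> andre_seq f (Suc m) r \<and> (\<forall>a\<in>{l..<m}. \<exists>k\<in>{Suc m..<r}. f a < f k)"
proof
  assume A: "andre_seq f l r"
  have "andre_seq f l m"
  proof (rule andre_seqI)
    fix a i assume ai: "l \<le> a" "a < i" "i < m" "\<And>j. a \<le> j \<Longrightarrow> j < i \<Longrightarrow> f i < f j"
    have "i < r" using ai \<open>m < r\<close> by simp
    obtain k where k: "i < k" "k < r" "\<And>j. i < j \<Longrightarrow> j \<le> k \<Longrightarrow> f i < f j" "f a < f k"
      using andre_seqD[OF A ai(1,2) \<open>i < r\<close> ai(4)] by blast
    have "k < m"
    proof (rule ccontr)
      assume "\<not> k < m"
      then have "f i < f m" using k(3) ai by simp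
      then show False using m[of i] ai \<open>i < r\<close> by simp
    qed
    then show "\<exists>k. i < k \<and> k < m \<and> (\<forall>j. i < j \<and> j \<le> k \<longrightarrow> f i < f j) \<and> f a < f k"
      using k by blast
  qed
  moreover have "andre_seq f (Suc m) r"
  proof (rule andre_seqI)
    fix a i assume ai: "Suc m \<le> a" "a < i" "i < r" "\<And>j. a \<le> j \<Longrightarrow> j < i \<Longrightarrow> f i < f j"
    have "l \<le> a" using ai \<open>l \<le> m\<close> by simp
    from A this ai(2-4) show "\<exists>k. i < k \<and> k < r \<and> (\<forall>j. i < j \<and> j \<le> k \<longrightarrow> f i < f j) \<and> f a < f k"
      by (rule andre_seqD) blast+
  qed
  moreover have "\<exists>k\<in>{Suc m..<r}. f a < f k" if a: "a \<in> {l..<m}" for a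
  proof -
    have "l \<le> a" "a < m" using a by auto
    moreover have "f m < f j" if "a \<le> j" "j < m" for j
      using m[of j] that a \<open>m < r\<close> by simp
    ultimately show ?thesis
      by (rule andre_seqD[OF A _ _ \<open>m < r\<close>]) auto
  qed
  ultimately show "andre_seq f l m \<and> andre_seq f (Suc m) r \<and>
      (\<forall>a\<in>{l..<m}. \<exists>k\<in>{Suc m..<r}. f a < f k)" by blast
next
  assume R: "andre_seq f l m \<and> andre_seq f (Suc m) r \<and>
      (\<forall>a\<in>{l..<m}. \<exists>k\<in>{Suc m..<r}. f a < f k)"
  show "andre_seq f l r"
  proof (rule andre_seqI)
    fix a i assume ai: "l \<le> a" "a < i" "i < r" "\<And>j. a \<le> j \<Longrightarrow> j < i \<Longrightarrow> f i < f j"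
    consider "i < m" | "i = m" | "m < a" | "m < i" "a \<le> m" by linarith
    then show "\<exists>k. i < k \<and> k < r \<and> (\<forall>j. i < j \<and> j \<le> k \<longrightarrow> f i < f j) \<and> f a < f k"
    proof cases
      case 1
      obtain k where k: "i < k" "k < m" "\<And>j. i < j \<Longrightarrow> j \<le> k \<Longrightarrow> f i < f j" "f a < f k"
        using andre_seqD[OF conjunct1[OF R] ai(1,2) 1 ai(4)] by blast
      then show ?thesis using \<open>m < r\<close> by (meson less_trans)
    next
      case 2
      obtain k where "k \<in> {Suc m..<r}" "f a < f k" using R 2 ai by force
      then show ?thesis using 2 m \<open>l \<le> m\<close> by (intro exI[of _ k]) auto
    next
      case 3
      have "Suc m \<le> a" using 3 by simp
      from conjunct1[OF conjunct2[OF R]] this ai(2-4) show ?thesis by (rule andre_seqD) blast+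
    next
      case 4
      have "f i < f m" using 4 by (intro ai(4))
      moreover have "f m < f i" using m[of i] 4 ai(3) \<open>l \<le> m\<close> by simp
      ultimately show ?thesis by simp
    qed
  qed
qed

text \<open>Both sides satisfy the same recursion at the position of the minimum, so induction on
  the length of the interval identifies them.\<close>

lemma andre_I_map_upt_iff:
  assumes "inj_on f {l..<r}" and "\<forall>j\<in>{l..<r}. 0 < f j"
  shows "andre_I (map f [l..<r]) \<longleftrightarrow> andre_seq f l r"
  using assms
proof (induction "r - l" arbitrary: l r rule: less_induct)
  case less
  show ?case
  proof (cases "l < r")
    case False
    then show ?thesis by (auto simp: andre_seq_def andre_I.empty)
  next
    case True
    define M where "M = Min (f ` {l..<r})"
    have "M \<in> f ` {l..<r}" unfolding M_def using True by (intro Min_in) auto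
    then obtain m where m: "l \<le> m" "m < r" "f m = M" by auto
    have min: "f m < f j" if "l \<le> j" "j < r" "j \<noteq> m" for j
    proof -
      have "f m \<le> f j" unfolding m(3) M_def using that by (intro Min_le) auto
      moreover have "f m \<noteq> f j" using less.prems(1) that m by (auto dest: inj_onD)
      ultimately show ?thesis by simp
    qed
    have upt: "[l..<r] = [l..<m] @ m # [Suc m..<r]"
      using upt_add_eq_append[of l m "r - m"] m by (simp add: upt_conv_Cons)
    have inj: "inj_on f {l..<m}" "inj_on f {Suc m..<r}"
      using m by (auto intro: inj_on_subset[OF less.prems(1)])
    have dist: "distinct (map f [l..<r])" using less.prems(1) by (simp add: distinct_map)
    have "andre_I (map f [l..<r]) \<longleftrightarrow> andre_I (map f [l..<m]) \<and> andre_I (map f [Suc m..<r]) \<and>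
        (\<forall>a\<in>set (map f [l..<m]). \<exists>b\<in>set (map f [Suc m..<r]). a < b)"
      unfolding upt map_append list.map
    proof (rule andre_I_split_iff)
      show "distinct (map f [l..<m] @ f m # map f [Suc m..<r])"
        using dist unfolding upt map_append list.map .
      show "\<forall>y\<in>set (map f [l..<m] @ f m # map f [Suc m..<r]). 0 < y"
        using less.prems(2) m by auto
      show "\<forall>y\<in>set (map f [l..<m]) \<union> set (map f [Suc m..<r]). f m < y"
        using min m by auto
    qed
    also have "\<dots> \<longleftrightarrow> andre_seq f l m \<and> andre_seq f (Suc m) r \<and>
        (\<forall>a\<in>{l..<m}. \<exists>k\<in>{Suc m..<r}. f a < f k)"
      using less.hyps[of m l] less.hyps[of r "Suc m"] inj less.prems(2) m by simp
    also have "\<dots> \<longleftrightarrow> andre_seq f l r"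
      using andre_seq_split_iff[of l m r f] m min by blast
    finally show ?thesis .
  qed
qed

section \<open>Reverse-complement of a factor\<close>

text \<open>
  Reflected form of the condition. Let \<open>c\<close> be the nearest position to the left of \<open>a\<close> with
  \<open>f c > f a\<close>. If all values between \<open>c\<close> and \<open>a\<close> exceeded \<open>f i\<close>, the condition applied
  to \<open>c\<close> and the position of the minimum on \<open>{c<..a}\<close> would produce a value larger than \<open>f c\<close>
  before position \<open>i\<close>, but all of these are at most \<open>f a\<close>.
\<close>

lemma andre_seq_reflected:
  assumes A: "andre_seq f 0 r" and inj: "inj_on f {0..<r}"
    and min: "\<And>j. 0 < j \<Longrightarrow> j < r \<Longrightarrow> f 0 < f j"
    and ai: "a < i" "i < r" "\<And>j. a < j \<Longrightarrow> j \<le> i \<Longrightarrow> f j < f a"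
  shows "\<exists>k<a. f k < f i \<and> (\<forall>j. k \<le> j \<and> j < a \<longrightarrow> f j < f a)"
proof (cases "\<exists>c<a. f a < f c")
  case False
  \<comment> \<open>Here \<open>f a\<close> exceeds everything before it, and the witness is
    position 0, which carries the overall minimum. The minimum also excludes \<open>a = 0\<close>,
    because \<open>f i < f a\<close>.\<close>
  have "0 < a" using ai(3)[of i] ai(1,2) min[of i] by (cases "a = 0") auto
  moreover have "f j < f a" if "j < a" for j
  proof -
    have "f j \<noteq> f a" using inj_onD[OF inj, of j a] that ai(1,2) by auto
    moreover have "f j \<le> f a" using False that by (meson not_less)
    ultimately show ?thesis by simp
  qed
  ultimately show ?thesis using min ai by (intro exI[of _ 0]) auto
next
  case True
  define c where "c = Max {c. c < a \<and> f a < f c}"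
  have fin: "finite {c. c < a \<and> f a < f c}" by simp
  have "c \<in> {c. c < a \<and> f a < f c}" unfolding c_def using True fin by (intro Max_in) auto
  then have c: "c < a" "f a < f c" by auto
  have below: "f j \<le> f a" if "c < j" "j \<le> a" for j
  proof (rule ccontr)
    assume "\<not> f j \<le> f a"
    then have "j \<in> {c. c < a \<and> f a < f c}" using that by (cases "j = a") auto
    then have "j \<le> c" unfolding c_def by (rule Max_ge[OF fin])
    then show False using that by simp
  qed
  have below': "f j < f a" if "c < j" "j < a" for j
  proof -
    have "f j \<noteq> f a" using inj_onD[OF inj, of j a] that ai(1,2) by auto
    then show ?thesis using below[of j] that by simp
  qed
  show ?thesis
  proof (cases "\<exists>k. c < k \<and> k < a \<and> f k < f i")
    case True
    then show ?thesis using below' by (meson less_le_trans)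
  next
    case no: False
    have above: "f i < f j" if "c < j" "j \<le> a" for j
    proof (cases "j = a")
      case False
      then have "j < a" using that by simp
      then have "f i \<le> f j" using no that(1) by (meson not_less)
      moreover have "f i \<noteq> f j" using that ai inj_onD[OF inj, of i j] by auto
      ultimately show ?thesis by simp
    qed (use ai(3)[of i] ai in simp)
    define E where "E = Min (f ` {c<..a})"
    have "E \<in> f ` {c<..a}" unfolding E_def using c by (intro Min_in) auto
    then obtain e where e: "c < e" "e \<le> a" "f e = E" by auto
    have emin: "f e \<le> f j" if "c < j" "j \<le> a" for j
      unfolding e(3) E_def using that by (intro Min_le) auto
    have "f e < f j" if "c \<le> j" "j < e" for j
    proof (cases "j = c")
      case True
      then show ?thesis using below[OF e(1,2)] c by simp
    next
      case False
      then have "f e \<le> f j" using that e emin by simp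
      moreover have "f e \<noteq> f j" using inj_onD[OF inj, of e j] that e ai by auto
      ultimately show ?thesis by simp
    qed
    moreover have "e < r" using e ai(1,2) by simp
    ultimately obtain k where
      k: "e < k" "k < r" "\<And>j. e < j \<Longrightarrow> j \<le> k \<Longrightarrow> f e < f j" "f c < f k"
      using andre_seqD[OF A le0 e(1)] by blast
    \<comment> \<open>The values after \<open>e\<close> up to \<open>k\<close> exceed
      \<open>f e\<close>, and \<open>f e\<close> exceeds \<open>f i\<close>; so \<open>k\<close>
      stops before \<open>i\<close>.\<close>
    have "k < i" using k(3)[of i] above[OF e(1,2)] e(2) ai by force
    then have "f k \<le> f a" using below[of k] ai(3)[of k] k(1) e by (cases "k \<le> a") auto
    then show ?thesis using k(4) c by simp
  qed
qed

lemma overline_conv_upt: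
  "overline N v = map (\<lambda>i. N - v ! (length v - Suc i)) [0..<length v]"
  by (rule nth_equalityI) (auto simp: overline_def rev_nth)

text \<open>Under the index reflection and the order reversal, \<open>andre_seq\<close> for the new
  word becomes the conclusion of \<open>andre_seq_reflected\<close>. Starting with the minimum
  matters: for \<open>N = 4\<close> the Andre I word 2 1 3 would become 1 3 2, which is not Andre
  I.\<close>

lemma andre_I_overline:
  assumes "andre_I v" and min: "\<forall>y\<in>set (tl v). hd v < y" and N: "\<forall>y\<in>set v. y < N"
  shows "andre_I (overline N v)"
proof -
  define r f h where "r = length v" and "f = (\<lambda>i. v ! i)" and "h = (\<lambda>i. N - f (r - Suc i))"
  have dp: "distinct v" "\<forall>y\<in>set v. 0 < y" using andre_I_distinct_pos[OF assms(1)] by auto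
  have inj: "inj_on f {0..<r}"
    using dp by (auto simp: inj_on_def f_def r_def nth_eq_iff_index_eq)
  have bound: "f j < N" if "j < r" for j using N that by (simp add: f_def r_def)
  have min': "f 0 < f j" if "0 < j" "j < r" for j
  proof -
    obtain y ys where "v = y # ys" using \<open>j < r\<close> unfolding r_def by (cases v) auto
    then show ?thesis using that min by (cases j) (auto simp: f_def r_def)
  qed
  have "andre_I (map f [0..<r])" using assms(1) by (simp add: f_def r_def map_nth)
  then have A: "andre_seq f 0 r"
    using andre_I_map_upt_iff[OF inj] dp by (auto simp: f_def r_def)
  have h_less: "h i < h j \<longleftrightarrow> f (r - Suc j) < f (r - Suc i)" if "i < r" "j < r" for i j
    using that bound[of "r - Suc i"] bound[of "r - Suc j"] by (auto simp: h_def)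
  have "andre_seq h 0 r"
  proof (rule andre_seqI)
    fix a i assume ai: "a < i" "i < r" "\<And>j. a \<le> j \<Longrightarrow> j < i \<Longrightarrow> h i < h j"
    \<comment> \<open>The segment from \<open>a\<close> to just before \<open>i\<close> is mirrored
      to the right of \<open>r - Suc i\<close>, and complementing turns larger into smaller.\<close>
    have "f j < f (r - Suc i)" if "r - Suc i < j" "j \<le> r - Suc a" for j
      using ai(3)[of "r - Suc j"] h_less[of i "r - Suc j"] that ai by auto
    moreover have "r - Suc i < r - Suc a" "r - Suc a < r" using ai(1,2) by auto
    ultimately obtain k where k: "k < r - Suc i" "f k < f (r - Suc a)"
      "\<And>j. k \<le> j \<Longrightarrow> j < r - Suc i \<Longrightarrow> f j < f (r - Suc i)"
      using andre_seq_reflected[OF A inj min', of "r - Suc i" "r - Suc a"] by blast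
    have "h i < h j" if "i < j" "j \<le> r - Suc k" for j
      using k(3)[of "r - Suc j"] k(1) that h_less[of i j] by auto
    moreover have "h a < h (r - Suc k)" using k ai h_less[of a "r - Suc k"] by auto
    moreover have "i < r - Suc k" "r - Suc k < r" using k ai by auto
    ultimately show "\<exists>k. i < k \<and> k < r \<and> (\<forall>j. i < j \<and> j \<le> k \<longrightarrow> h i < h j) \<and> h a < h k"
      by blast
  qed
  moreover have "inj_on h {0..<r}"
  proof (rule inj_onI)
    fix i j assume ij: "i \<in> {0..<r}" "j \<in> {0..<r}" "h i = h j"
    then have "f (r - Suc i) = f (r - Suc j)"
      using bound[of "r - Suc i"] bound[of "r - Suc j"] by (auto simp: h_def)
    then have "r - Suc i = r - Suc j" using inj_onD[OF inj] ij by auto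
    then show "i = j" using ij by auto
  qed
  moreover have "\<forall>j\<in>{0..<r}. 0 < h j" using bound by (simp add: h_def)
  ultimately have "andre_I (map h [0..<r])" using andre_I_map_upt_iff by blast
  then show ?thesis unfolding overline_conv_upt h_def f_def r_def .
qed

section \<open>Canonical factorizations\<close>

text \<open>A characterization of the canonical factorization that mentions no positions. The lemmas
  below give its uniqueness, and its existence for words with distinct letters.\<close>

definition left_min_factors :: "nat list list \<Rightarrow> bool" where
  "left_min_factors vs \<longleftrightarrow> (\<forall>v\<in>set vs. v \<noteq> [] \<and> (\<forall>y\<in>set (tl v). hd v < y)) \<and>
     sorted_wrt (\<lambda>u v. hd v < hd u) vs"

lemma hd_le_if_left_min_factors:
  assumes "left_min_factors vs" "v \<in> set vs" "y \<in> set v"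
  shows "hd v \<le> y"
  using assms unfolding left_min_factors_def by (cases v) fastforce+

text \<open>The last factor begins at the minimum of the whole word. Inductions that remove factors
  from the right therefore cut exactly where the Andre I recursion does.\<close>

lemma left_min_factors_snoc:
  "left_min_factors (vs @ [m # s]) \<longleftrightarrow>
     left_min_factors vs \<and> (\<forall>y \<in> set (concat vs) \<union> set s. m < y)" (is "?L \<longleftrightarrow> ?R")
proof
  assume L: ?L
  then have vs: "left_min_factors vs" by (simp add: left_min_factors_def sorted_wrt_append)
  moreover have "m < y" if "v \<in> set vs" "y \<in> set v" for v y
    using L that hd_le_if_left_min_factors[OF vs that]
    by (auto simp: left_min_factors_def sorted_wrt_append intro: less_le_trans)
  moreover have "m < y" if "y \<in> set s" for y using L that by (simp add: left_min_factors_def)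
  ultimately show ?R by auto
next
  assume R: ?R
  then have "m < hd v" if "v \<in> set vs" for v
    using that hd_in_set[of v] unfolding left_min_factors_def set_concat by blast
  then show ?L using R by (auto simp: left_min_factors_def sorted_wrt_append)
qed

lemma left_min_positions_append:
  assumes "\<forall>y \<in> set w \<union> set s. m < y"
  shows "left_min_positions (w @ m # s) = left_min_positions w @ [length w]"
proof -
  let ?u = "w @ m # s"
  let ?P = "\<lambda>u i. \<forall>j<i. u ! i < u ! j"
  have upt: "[0..<length ?u] = [0..<length w] @ length w # [Suc (length w)..<length ?u]"
    using upt_add_eq_append[of 0 "length w" "Suc (length s)"]
    by (simp add: upt_conv_Cons del: upt_Suc)
  have "filter (?P ?u) [0..<length w] = filter (?P w) [0..<length w]"
    by (intro filter_cong) (auto simp: nth_append)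
  moreover have "?P ?u (length w)" using assms by (auto simp: nth_append)
  moreover have "filter (?P ?u) [Suc (length w)..<length ?u] = []"
  proof -
    have "\<not> ?P ?u i" if "Suc (length w) \<le> i" "i < length ?u" for i
    proof -
      have "?u ! i \<in> set s" using that by (auto simp: nth_append nth_Cons split: nat.splits)
      then have "m < ?u ! i" using assms by blast
      then have "\<not> ?u ! i < ?u ! length w" by simp
      then show ?thesis using that by (metis Suc_le_lessD)
    qed
    then show ?thesis unfolding filter_empty_conv set_upt by (meson atLeastLessThan_iff)
  qed
  ultimately show ?thesis unfolding left_min_positions_def upt by simp
qed

lemma canonical_factorization_append:
  assumes "\<forall>y \<in> set w \<union> set s. m < y"
  shows "canonical_factorization (w @ m # s) = canonical_factorization w @ [m # s]"
proof -
  let ?u = "w @ m # s" and ?p = "left_min_positions w"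
  \<comment> \<open>The end marker \<open>length w\<close> of the shorter word becomes the record
    position of \<open>m\<close>, so all earlier slices keep their boundaries.\<close>
  let ?a = "?p @ [length w]" and ?b = "(?p @ [length w]) @ [length ?u]"
  have a_le: "?a ! j \<le> length w" if "j < length ?a" for j
  proof -
    have "?a ! j \<in> set ?a" using that nth_mem by blast
    then show ?thesis by (auto simp: left_min_positions_def)
  qed
  have "map ((!) ?u) [?b ! j..<?b ! Suc j] = map ((!) w) [?a ! j..<?a ! Suc j]"
    if j: "j < length ?p" for j
  proof -
    have "?b ! j = ?a ! j" "?b ! Suc j = ?a ! Suc j" using j by (simp_all only: nth_append) auto
    then show ?thesis using a_le[of "Suc j"] j by (auto simp: nth_append)
  qed
  moreover have "map ((!) ?u) [?b ! length ?p..<?b ! Suc (length ?p)] = m # s"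
    by (rule nth_equalityI) (auto simp: nth_append simp del: upt_Suc)
  ultimately show ?thesis
    unfolding canonical_factorization_def Let_def left_min_positions_append[OF assms] by simp
qed

lemma canonical_factorization_concat:
  "left_min_factors vs \<Longrightarrow> canonical_factorization (concat vs) = vs"
proof (induction vs rule: rev_induct)
  case Nil
  then show ?case by (simp add: canonical_factorization_def left_min_positions_def)
next
  case (snoc v vs)
  then obtain m s where "v = m # s" by (cases v) (auto simp: left_min_factors_def)
  then show ?case using snoc by (simp add: left_min_factors_snoc canonical_factorization_append)
qed

text \<open>The suffix starting at the minimum is the last factor; the prefix before it is factored
  recursively.\<close>

lemma obtain_left_min_factors:
  assumes "distinct w"
  obtains vs where "left_min_factors vs" "concat vs = w"
proof -
  have "\<exists>vs. left_min_factors vs \<and> concat vs = w"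
    using assms
  proof (induction "length w" arbitrary: w rule: less_induct)
    case less
    show ?case
    proof (cases "w = []")
      case True
      then show ?thesis by (intro exI[of _ "[]"]) (simp add: left_min_factors_def)
    next
      case False
      define m where "m = Min (set w)"
      have "m \<in> set w" unfolding m_def using False by (intro Min_in) auto
      then obtain p s where w: "w = p @ m # s" by (auto dest: split_list)
      obtain vs where vs: "left_min_factors vs" "concat vs = p"
        using less.hyps[of p] less.prems w by auto
      have "m < y" if "y \<in> set p \<union> set s" for y
      proof -
        have "m \<le> y" unfolding m_def using that w by (intro Min_le) auto
        moreover have "m \<noteq> y" using that less.prems w by auto
        ultimately show ?thesis by simp
      qed
      then show ?thesis
        using vs w by (intro exI[of _ "vs @ [m # s]"]) (simp add: left_min_factors_snoc)
    qed
  qed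
  then show ?thesis using that by blast
qed

text \<open>Removing the last factor \<open>m # s\<close> is the split at the minimum. Since Andre I
  words end in their maximum, domination of the earlier factors by \<open>s\<close> amounts to a
  comparison of last letters.\<close>

lemma andre_I_concat_iff:
  assumes "left_min_factors vs" "distinct (concat vs)" "\<forall>y\<in>set (concat vs). 0 < y"
  shows "andre_I (concat vs) \<longleftrightarrow>
    (\<forall>v\<in>set vs. andre_I v) \<and> sorted_wrt (\<lambda>u v. last u < last v) vs"
  using assms
proof (induction vs rule: rev_induct)
  case Nil
  then show ?case by (simp add: andre_I.empty)
next
  case (snoc v vs)
  then obtain m s where v: "v = m # s" by (cases v) (auto simp: left_min_factors_def)
  have vs: "left_min_factors vs" and less: "\<forall>y \<in> set (concat vs) \<union> set s. m < y"
    using snoc.prems(1) unfolding v left_min_factors_snoc by auto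
  have ne: "u \<noteq> []" if "u \<in> set vs" for u using vs that by (auto simp: left_min_factors_def)
  have IH: "andre_I (concat vs) \<longleftrightarrow>
      (\<forall>v\<in>set vs. andre_I v) \<and> sorted_wrt (\<lambda>u v. last u < last v) vs"
    using snoc.IH[OF vs] snoc.prems by simp
  have v_iff: "andre_I v \<longleftrightarrow> andre_I s"
    using andre_I_split_iff[of "[]" m s] snoc.prems less by (auto simp: v andre_I.empty)
  have "andre_I (concat (vs @ [v])) \<longleftrightarrow> andre_I (concat vs) \<and> andre_I s \<and>
      (\<forall>a\<in>set (concat vs). \<exists>b\<in>set s. a < b)"
    using andre_I_split_iff[of "concat vs" m s] snoc.prems less by (simp add: v)
  also have "\<dots> \<longleftrightarrow> andre_I (concat vs) \<and> andre_I v \<and> (\<forall>u\<in>set vs. last u < last v)"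
  proof -
    have "(\<forall>a\<in>set (concat vs). \<exists>b\<in>set s. a < b) \<longleftrightarrow> (\<forall>u\<in>set vs. last u < last v)"
      if A: "andre_I (concat vs)" "andre_I v"
    proof
      assume *: "\<forall>a\<in>set (concat vs). \<exists>b\<in>set s. a < b"
      show "\<forall>u\<in>set vs. last u < last v"
      proof
        fix u assume u: "u \<in> set vs"
        then have "last u \<in> set (concat vs)" using last_in_set[OF ne[OF u]] by auto
        then obtain b where "b \<in> set s" "last u < b" using * by blast
        moreover have "b \<le> last v" using le_last_if_andre_I[OF A(2)] calculation v by simp
        ultimately show "last u < last v" by simp
      qed
    next
      assume *: "\<forall>u\<in>set vs. last u < last v"
      show "\<forall>a\<in>set (concat vs). \<exists>b\<in>set s. a < b"
      proof
        fix a assume a: "a \<in> set (concat vs)"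
        then obtain u where u: "u \<in> set vs" "a \<in> set u" by auto
        have "andre_I u" using A(1) IH u by blast
        then have "a < last v" using le_last_if_andre_I u * by (meson le_less_trans)
        moreover have "m < a" using less a by blast
        \<comment> \<open>If \<open>s\<close> were empty, \<open>last v\<close> would be
          \<open>m\<close>, contradicting \<open>m < a\<close> and
          \<open>a < last v\<close>.\<close>
        ultimately have "s \<noteq> []" using v by auto
        then show "\<exists>b\<in>set s. a < b" using \<open>a < last v\<close> v last_in_set[of s] by auto
      qed
    qed
    then show ?thesis using v_iff by blast
  qed
  also have "\<dots> \<longleftrightarrow> (\<forall>v\<in>set (vs @ [v]). andre_I v) \<and>
      sorted_wrt (\<lambda>u v. last u < last v) (vs @ [v])"
    using IH by (auto simp: sorted_wrt_append)
  finally show ?case .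
qed

text \<open>The first factor is the longest prefix whose letters are all at least the first letter.
  What follows it is the smaller first letter of the next factor, or the conventional 0.\<close>

lemma spi_concat:
  assumes "left_min_factors (v # vs)" "\<forall>y\<in>set (concat (v # vs)). 0 < y"
  shows "spi (concat (v # vs)) = last v"
proof -
  let ?w = "concat (v # vs)"
  let ?P = "\<lambda>i. i < length ?w \<and> (\<forall>j\<le>i. ?w ! 0 \<le> ?w ! j) \<and> ?w ! 0 > (?w @ [0]) ! Suc i"
  have v: "v \<noteq> []" and pos: "0 < hd v" using assms by (auto simp: left_min_factors_def)
  have w0: "?w ! 0 = hd v" using v by (simp add: nth_append hd_conv_nth)
  have ge: "?w ! 0 \<le> ?w ! j" if "j < length v" for j
    using hd_le_if_left_min_factors[OF assms(1), of v "v ! j"] that w0 by (simp add: nth_append)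
  have next_less: "?w ! 0 > (?w @ [0]) ! length v"
  proof (cases vs)
    case Nil
    then show ?thesis using w0 pos by (simp add: nth_append)
  next
    case (Cons u us)
    then have "u \<noteq> []" "hd u < hd v" using assms by (auto simp: left_min_factors_def)
    then show ?thesis using w0 Cons by (simp add: nth_append hd_conv_nth)
  qed
  have "(THE i. ?P i) = length v - 1"
  proof (rule the_equality)
    have l: "0 < length v" using v by simp
    have "length v - 1 < length ?w" using l by (simp add: less_imp_diff_less trans_less_add1)
    moreover have "?w ! 0 \<le> ?w ! j" if "j \<le> length v - 1" for j
      using that l by (intro ge) linarith
    moreover have "?w ! 0 > (?w @ [0]) ! Suc (length v - 1)" using l next_less by simp
    ultimately show "?P (length v - 1)" by blast
  next
    fix i assume i: "?P i"
    have "\<not> i < length v - 1"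
    proof
      assume "i < length v - 1"
      then have "?w ! 0 \<le> ?w ! Suc i" "Suc i < length ?w" using ge[of "Suc i"] by auto
      moreover have "(?w @ [0]) ! Suc i = ?w ! Suc i" using calculation(2) by (rule nth_append_left)
      ultimately show False using i by linarith
    qed
    \<comment> \<open>A prefix reaching beyond the first factor contains the position
      \<open>length v\<close>, whose letter is too small.\<close>
    moreover have "\<not> length v \<le> i"
    proof
      assume l: "length v \<le> i"
      have "?w ! 0 \<le> ?w ! length v" using i l by blast
      moreover have "length v < length ?w" using i l by linarith
      moreover have "(?w @ [0]) ! length v = ?w ! length v"
        using calculation(2) by (rule nth_append_left)
      ultimately show False using next_less by linarith
    qed
    ultimately show "i = length v - 1" by simp
  qed
  then show ?thesis using v unfolding spi_def by (simp add: nth_append last_conv_nth)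
qed

section \<open>The involution\<close>

lemma hd_overline: "v \<noteq> [] \<Longrightarrow> hd (overline N v) = N - last v"
  by (simp add: overline_def hd_rev last_map)

lemma last_overline: "v \<noteq> [] \<Longrightarrow> last (overline N v) = N - hd v"
  by (simp add: overline_def last_rev hd_map)

lemma overline_overline: "\<forall>y\<in>set v. y \<le> N \<Longrightarrow> overline N (overline N v) = v"
  by (simp add: overline_def rev_map map_idI)

text \<open>Reversal inside the factors is invisible to multisets; this is how the letters of
  \<open>g n w\<close> and their distinctness are controlled.\<close>

lemma mset_concat_map_overline:
  "mset (concat (map (overline N) vs)) = mset (map (\<lambda>y. N - y) (concat vs))"
  by (induction vs) (simp_all add: overline_def)

text \<open>The maximum at the end of a factor turns into a minimum at its start, and increasing
  last letters turn into decreasing first letters. Hence the new factors are again a canonical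
  factorization.\<close>

lemma left_min_factors_map_overline:
  assumes "left_min_factors vs" "\<forall>v\<in>set vs. andre_I v \<and> (\<forall>y\<in>set v. y < N)"
    "sorted_wrt (\<lambda>u v. last u < last v) vs"
  shows "left_min_factors (map (overline N) vs)"
proof -
  have ne: "v \<noteq> []" if "v \<in> set vs" for v using that assms by (auto simp: left_min_factors_def)
  have "N - last v < y" if v: "v \<in> set vs" and y: "y \<in> set (tl (overline N v))" for v y
  proof -
    obtain u x where vu: "v = u @ [x]" using ne[OF v] by (cases v rule: rev_cases) auto
    then obtain z where z: "z \<in> set u" "y = N - z" using y by (auto simp: overline_def)
    have "andre_I v" using assms v by blast
    then have "z \<le> x" "z \<noteq> x"
      using le_last_if_andre_I[of v z] andre_I_distinct_pos[of v] z vu by auto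
    moreover have "x < N" using assms v vu by auto
    ultimately show ?thesis using z vu by simp
  qed
  moreover have "sorted_wrt (\<lambda>u v. hd (overline N v) < hd (overline N u)) vs"
    using assms(3)
  proof (rule sorted_wrt_mono_rel[rotated])
    fix u v assume uv: "u \<in> set vs" "v \<in> set vs" "last u < last v"
    then have "last v < N" using assms(2) ne by auto
    then show "hd (overline N v) < hd (overline N u)" using uv ne by (simp add: hd_overline)
  qed
  ultimately show ?thesis
    using ne by (auto simp: left_min_factors_def sorted_wrt_map hd_overline) 
      (simp add: overline_def)
qed

lemma g_And_I:
  assumes w: "w \<in> And_I n"
  shows "g n w \<in> And_I n" "g n (g n w) = w"
    "factorization_type (g n w) = map (\<lambda>(p, q). (n + 1 - q, n + 1 - p)) (factorization_type w)"
    "0 < n \<Longrightarrow> hd (g n w) = n + 1 - spi w" "0 < n \<Longrightarrow> spi (g n w) = n + 1 - hd w"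
proof -
  let ?N = "n + 1"
  have set_w: "set w = {1..n}" and dw: "distinct w" and A: "andre_I w"
    using w by (auto simp: And_I_def permutations_of_set_def)
  obtain vs where vs: "left_min_factors vs" "concat vs = w"
    using obtain_left_min_factors[OF dw] by blast
  let ?us = "map (overline ?N) vs"
  have cf: "canonical_factorization w = vs" using canonical_factorization_concat vs by blast
  have ne: "v \<noteq> []" if "v \<in> set vs" for v using that vs by (auto simp: left_min_factors_def)
  have lt: "y < ?N" if "v \<in> set vs" "y \<in> set v" for v y
  proof -
    have "y \<in> set w" using that vs by auto
    then show ?thesis using set_w by simp
  qed
  have Avs: "\<forall>v\<in>set vs. andre_I v" and sorted: "sorted_wrt (\<lambda>u v. last u < last v) vs"
    using andre_I_concat_iff[OF vs(1)] A dw set_w vs by auto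
  have us: "left_min_factors ?us"
    using left_min_factors_map_overline vs Avs sorted lt by blast
  have gw: "g n w = concat ?us" by (simp add: g_def cf)
  have cfg: "canonical_factorization (g n w) = ?us"
    unfolding gw by (rule canonical_factorization_concat[OF us])
  have m: "mset (g n w) = mset (map (\<lambda>y. ?N - y) w)"
    unfolding gw mset_concat_map_overline vs(2) ..
  have "(\<lambda>y. ?N - y) ` {1..n} = {1..n}"
  proof (intro equalityI subsetI)
    fix x assume "x \<in> {1..n}"
    then show "x \<in> (\<lambda>y. ?N - y) ` {1..n}" by (intro image_eqI[of _ _ "?N - x"]) auto
  qed auto
  then have set_g: "set (g n w) = {1..n}" using mset_eq_setD[OF m] set_w by simp
  have "inj_on (\<lambda>y. ?N - y) {1..n}" by (auto simp: inj_on_def)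
  then have dg: "distinct (g n w)"
    using mset_eq_imp_distinct_iff[OF m] dw set_w by (simp add: distinct_map)
  have "andre_I (overline ?N v)" if "v \<in> set vs" for v
    using andre_I_overline[of v ?N] Avs that vs(1) lt by (auto simp: left_min_factors_def)
  moreover have "sorted_wrt (\<lambda>u v. last u < last v) ?us"
  proof -
    have "sorted_wrt (\<lambda>u v. hd v < hd u) vs" using vs by (simp add: left_min_factors_def)
    then have "sorted_wrt (\<lambda>u v. last (overline ?N u) < last (overline ?N v)) vs"
    proof (rule sorted_wrt_mono_rel[rotated])
      fix u v assume uv: "u \<in> set vs" "v \<in> set vs" "hd v < hd u"
      then have "hd u < ?N" using lt[of u "hd u"] ne by simp
      then show "last (overline ?N u) < last (overline ?N v)"
        using uv ne by (simp add: last_overline)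
    qed
    then show ?thesis by (simp add: sorted_wrt_map)
  qed
  moreover have "\<forall>y\<in>set (concat ?us). 0 < y" using set_g unfolding gw by simp
  ultimately have "andre_I (g n w)"
    using andre_I_concat_iff[OF us] dg unfolding gw by simp
  then show "g n w \<in> And_I n" using dg set_g by (simp add: And_I_def permutations_of_set_def)
  \<comment> \<open>A second application of \<open>g\<close> acts on the factors \<open>?us\<close>
    themselves and undoes the first one factor by factor.\<close>
  have "map (overline ?N) ?us = vs"
    using lt by (simp add: overline_overline less_imp_le map_idI)
  then show "g n (g n w) = w" unfolding g_def[of n "g n w"] cfg using vs by simp
  show "factorization_type (g n w) =
      map (\<lambda>(p, q). (n + 1 - q, n + 1 - p)) (factorization_type w)"
    unfolding factorization_type_def cfg cf using ne by (simp add: hd_overline last_overline)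
  assume "0 < n"
  then have "vs \<noteq> []" using vs set_w by auto
  then obtain v vs' where v: "vs = v # vs'" by (cases vs) auto
  have "v \<noteq> []" using ne v by simp
  then have ov: "overline ?N v \<noteq> []" by (simp add: overline_def)
  have "spi w = last v" using spi_concat[of v vs'] vs set_w v by force
  moreover have "hd w = hd v" using vs v \<open>v \<noteq> []\<close> by auto
  moreover have "hd (g n w) = hd (overline ?N v)" using gw v ov by simp
  moreover have "spi (g n w) = last (overline ?N v)"
    using spi_concat[of "overline ?N v" "map (overline ?N) vs'"] us gw set_g v by force
  ultimately show "hd (g n w) = n + 1 - spi w" "spi (g n w) = n + 1 - hd w"
    using \<open>v \<noteq> []\<close> by (simp_all add: hd_overline last_overline)
qed

theorem theorem4p3:
  fixes n :: nat
  assumes "n \<ge> 3"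
  shows "bij_betw (g n) (And_I n) (And_I n) \<and>
    (\<forall>w \<in> And_I n.
      factorization_type (g n w) =
        map (\<lambda>(p, q). (n + 1 - q, n + 1 - p)) (factorization_type w) \<and>
      (F_letter (g n w), spi (g n w)) = (n + 1 - spi w, n + 1 - F_letter w))"
proof
  show "bij_betw (g n) (And_I n) (And_I n)"
    \<comment> \<open>Being an involution on \<open>And_I n\<close>, the map serves as its own
      inverse.\<close>
    by (rule bij_betw_byWitness[of _ "g n"]) (auto simp: g_And_I)
qed (use assms g_And_I in auto)

end
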